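(* Let $n$, $k$ and $i$ be integers such that $n\ge i$ and $1\le i\le k\le n-1$, and let $G$ be a connected graph of order $n$ with $\Delta(G)=k$. Then $t_i(G)\le n-k+i$. Moreover, this bound is sharp, i.e. there are graphs for which equality holds.
   Context: All graphs are finite, simple and undirected. $N_G(v)$ is the open neighborhood of $v$ and $\Delta(G)$ the maximum degree. A vertex coloring of $G$ is any assignment $f$ of colors to the vertices (adjacent vertices may receive the same color). For a positive integer $i$, $f$ is an $N_i$-vertex coloring if $|\{f(x): x\in N_G(v)\}|\le i$ for every $v\in V(G)$. The $N_i$-chromatic number $t_i(G)$ is the maximum number of colors used in an $N_i$-vertex coloring of $G$. *)

theory Defs
  imports "Graph_Theory.Graph_Theory"
begin

text \<open>
  A finite simple undirected graph is a \<open>pair_graph\<close>: a finite loopfree digraph without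
  parallel arcs whose arc relation is symmetric, so that an edge is a pair of opposite arcs.
\<close>

definition nbhd :: "'a pair_pre_digraph \<Rightarrow> 'a \<Rightarrow> 'a set" where
  "nbhd G v = {u. v \<rightarrow>\<^bsub>G\<^esub> u}"

text \<open>The arc relation being symmetric, the degree of a vertex is its out-degree.\<close>

definition max_degree :: "'a pair_pre_digraph \<Rightarrow> nat" where
  "max_degree G = Max (out_degree G ` pverts G)"

definition N_coloring :: "nat \<Rightarrow> 'a pair_pre_digraph \<Rightarrow> ('a \<Rightarrow> 'c) \<Rightarrow> bool" where
  "N_coloring i G f \<longleftrightarrow> (\<forall>v \<in> pverts G. card (f ` nbhd G v) \<le> i)"

text \<open>
  Natural numbers suffice as colors, since only the finitely many values of a coloring on the
  vertices matter. For a finite graph and \<open>i \<ge> 1\<close> the set below is finite, and nonempty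
  because constant colorings qualify.
\<close>

definition N_chromatic_number :: "nat \<Rightarrow> 'a pair_pre_digraph \<Rightarrow> nat" where
  "N_chromatic_number i G =
     Max {card (f ` pverts G) | f :: 'a \<Rightarrow> nat. N_coloring i G f}"

end

theory Submission
  imports Defs
begin

text \<open>
  A vertex \<open>v\<close> of maximum degree \<open>k\<close> splits the vertex set into its neighborhood, which has
  \<open>k\<close> elements and carries at most \<open>i\<close> colors, and the remaining \<open>n - k\<close> vertices, which
  carry at most one color each. Hence no \<open>N\<^sub>i\<close>-coloring has more than \<open>n - k + i\<close> colors
  (lemma \<open>N_coloring_card_colors_le\<close>).

  The star with \<open>k\<close> leaves attains the bound for every \<open>1 \<le> i \<le> k\<close>. Here \<open>n - k = 1\<close>, so
  \<open>i + 1\<close> colors are called for: give the center a color of its own and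
  distribute \<open>i\<close> further colors over the leaves. The center then sees exactly these \<open>i\<close>
  colors, and each leaf sees only the color of the center
  (lemma \<open>N_chromatic_number_star\<close>).
\<close>

lemma card_nbhd: "card (nbhd G v) = out_degree G v"
proof -
  have "out_arcs G v = Pair v ` nbhd G v"
    by (auto simp: out_arcs_def nbhd_def)
  then show ?thesis
    by (simp add: out_degree_def card_image inj_on_def)
qed

lemma (in pair_wf_digraph) nbhd_subset_pverts: "nbhd G v \<subseteq> pverts G"
  by (auto simp: nbhd_def dest: in_arcsD2)

text \<open>
  The neighbors of \<open>v\<close> share at most \<open>i\<close> colors; the colors of the other vertices are limited
  by their number alone, so a vertex of larger degree gives a better bound.
\<close>

lemma (in pair_fin_digraph) N_coloring_card_colors_le:
  assumes "N_coloring i G f" and "v \<in> pverts G"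
  shows "card (f ` pverts G) \<le> card (pverts G) - out_degree G v + i"
proof -
  let ?N = "nbhd G v"
  have fin: "finite (pverts G)"
    by (rule pair_finite_verts)
  have sub: "?N \<subseteq> pverts G"
    by (rule nbhd_subset_pverts)
  then have "f ` pverts G = f ` (pverts G - ?N) \<union> f ` ?N"
    by blast
  then have "card (f ` pverts G) \<le> card (f ` (pverts G - ?N)) + card (f ` ?N)"
    by (simp add: card_Un_le)
  also have "\<dots> \<le> card (pverts G - ?N) + i"
    using assms fin by (intro add_mono card_image_le) (auto simp: N_coloring_def)
  also have "card (pverts G - ?N) = card (pverts G) - out_degree G v"
    using card_Diff_subset[OF finite_subset[OF sub fin] sub] by (simp add: card_nbhd)
  finally show ?thesis .
qed

lemma (in pair_fin_digraph) max_degree_attained: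
  assumes "pverts G \<noteq> {}"
  obtains v where "v \<in> pverts G" and "out_degree G v = max_degree G"
proof -
  have "max_degree G \<in> out_degree G ` pverts G"
    unfolding max_degree_def using assms pair_finite_verts by (intro Max_in) auto
  then show ?thesis
    using that by auto
qed

lemma (in pair_fin_digraph) finite_color_counts:
  "finite {card (f ` pverts G) | f :: 'a \<Rightarrow> nat. N_coloring i G f}"
  by (rule finite_subset[of _ "{..card (pverts G)}"])
    (auto intro: card_image_le pair_finite_verts)

text \<open>
  Here \<open>1 \<le> i\<close> makes the constant coloring admissible, so that the maximum defining the
  chromatic number ranges over a nonempty set.
\<close>

lemma (in pair_fin_digraph) N_chromatic_number_leI:
  assumes "1 \<le> i"
    and bound: "\<And>f :: 'a \<Rightarrow> nat. N_coloring i G f \<Longrightarrow> card (f ` pverts G) \<le> m"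
  shows "N_chromatic_number i G \<le> m"
proof -
  have "N_coloring i G (\<lambda>_. 0 :: nat)"
    using \<open>1 \<le> i\<close> by (auto simp: N_coloring_def image_constant_conv)
  then have "{card (f ` pverts G) | f :: 'a \<Rightarrow> nat. N_coloring i G f} \<noteq> {}"
    by blast
  then show ?thesis
    unfolding N_chromatic_number_def
    by (intro Max.boundedI finite_color_counts) (auto intro: bound)
qed

lemma (in pair_fin_digraph) N_coloring_card_le_N_chromatic_number:
  fixes f :: "'a \<Rightarrow> nat"
  assumes "N_coloring i G f"
  shows "card (f ` pverts G) \<le> N_chromatic_number i G"
  unfolding N_chromatic_number_def using assms by (intro Max_ge finite_color_counts) auto

lemma (in pair_fin_digraph) N_chromatic_number_le:
  assumes "pverts G \<noteq> {}" and "1 \<le> i"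
  shows "N_chromatic_number i G \<le> card (pverts G) - max_degree G + i"
proof -
  obtain v where "v \<in> pverts G" and "out_degree G v = max_degree G"
    using max_degree_attained[OF assms(1)] .
  then show ?thesis
    using assms(2) N_coloring_card_colors_le by (intro N_chromatic_number_leI) force+
qed

text \<open>The star \<open>K\<^sub>1\<^sub>,\<^sub>k\<close> with center \<open>0\<close>.\<close>

definition star :: "nat \<Rightarrow> nat pair_pre_digraph" where
  "star k = \<lparr> pverts = {0..k}, parcs = {0} \<times> {1..k} \<union> {1..k} \<times> {0} \<rparr>"

lemma pverts_star [simp]: "pverts (star k) = {0..k}"
  and parcs_star [simp]: "parcs (star k) = {0} \<times> {1..k} \<union> {1..k} \<times> {0}"
  by (simp_all add: star_def)

lemma pair_graph_star: "pair_graph (star k)"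
  by unfold_locales (auto simp: symmetric_def sym_def)

lemma connected_star: "Digraph_Component.connected (star k)"
proof -
  interpret pair_graph "star k"
    by (rule pair_graph_star)
  have to_center: "u \<rightarrow>\<^sup>*\<^bsub>star k\<^esub> 0" and from_center: "0 \<rightarrow>\<^sup>*\<^bsub>star k\<^esub> u" if "u \<le> k" for u
    using that by (cases "u = 0"; force)+
  show ?thesis
    by (rule connectedI) (auto intro: reachable_mk_symmetricI reachable_trans to_center from_center)
qed

lemma nbhd_star:
  assumes "v \<le> k"
  shows "nbhd (star k) v = (if v = 0 then {1..k} else {0})"
  using assms by (auto simp: nbhd_def)

lemma max_degree_star:
  assumes "1 \<le> k"
  shows "max_degree (star k) = k"
  unfolding max_degree_def
proof (rule Max_eqI)
  show "d \<le> k" if "d \<in> out_degree (star k) ` pverts (star k)" for d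
    using that assms by (auto simp: nbhd_star simp flip: card_nbhd)
  show "k \<in> out_degree (star k) ` pverts (star k)"
    by (rule image_eqI[of _ _ 0]) (auto simp: nbhd_star simp flip: card_nbhd)
qed simp

text \<open>
  Truncating the labels at \<open>i\<close> is an extremal coloring: the center keeps the color \<open>0\<close> for itself
  and the leaves get exactly the colors \<open>1, \<dots>, i\<close>.
\<close>

lemma N_chromatic_number_star:
  assumes "1 \<le> i" and "i \<le> k"
  shows "N_chromatic_number i (star k) = i + 1"
proof (rule antisym)
  interpret pair_graph "star k"
    by (rule pair_graph_star)
  show "N_chromatic_number i (star k) \<le> i + 1"
    using N_chromatic_number_le[of i] assms by (simp add: max_degree_star)
  let ?f = "\<lambda>v. min v i"
  have "?f ` {1..k} \<subseteq> {1..i}"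
    using assms by auto
  then have "card (?f ` {1..k}) \<le> i"
    using card_mono[of "{1..i}"] by fastforce
  then have "N_coloring i (star k) ?f"
    using assms by (auto simp: N_coloring_def nbhd_star)
  then have "card (?f ` pverts (star k)) \<le> N_chromatic_number i (star k)"
    by (rule N_coloring_card_le_N_chromatic_number)
  moreover have "?f ` {0..k} = {0..i}"
    using assms by (force simp: image_iff min_def)
  ultimately show "i + 1 \<le> N_chromatic_number i (star k)"
    by simp
qed

theorem theorem2p6:
  shows "(\<forall>(n::nat) (k::nat) (i::nat) (G :: 'a pair_pre_digraph).
            i \<le> n \<and> 1 \<le> i \<and> i \<le> k \<and> k \<le> n - 1 \<and>
            pair_graph G \<and> Digraph_Component.connected G \<and>
            card (pverts G) = n \<and> max_degree G = k
            \<longrightarrow> N_chromatic_number i G \<le> n - k + i)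
       \<and> (\<forall>(k::nat) (i::nat). 1 \<le> i \<and> i \<le> k \<longrightarrow>
            (\<exists>(n::nat) (G :: nat pair_pre_digraph).
               i \<le> n \<and> k \<le> n - 1 \<and>
               pair_graph G \<and> Digraph_Component.connected G \<and>
               card (pverts G) = n \<and> max_degree G = k \<and>
               N_chromatic_number i G = n - k + i))"
proof (intro conjI allI impI; elim conjE)
  fix n k i :: nat and G :: "'a pair_pre_digraph"
  assume "i \<le> n" and "1 \<le> i" and "pair_graph G"
    and n: "card (pverts G) = n" and k: "max_degree G = k"
  interpret pair_graph G
    by fact
  have "pverts G \<noteq> {}"
    using \<open>1 \<le> i\<close> \<open>i \<le> n\<close> n by auto
  then show "N_chromatic_number i G \<le> n - k + i"
    using N_chromatic_number_le \<open>1 \<le> i\<close> n k by blast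
next
  fix k i :: nat
  assume "1 \<le> i" and "i \<le> k"
  then show "\<exists>(n::nat) (G :: nat pair_pre_digraph).
      i \<le> n \<and> k \<le> n - 1 \<and> pair_graph G \<and> Digraph_Component.connected G \<and>
      card (pverts G) = n \<and> max_degree G = k \<and> N_chromatic_number i G = n - k + i"
    by (intro exI[of _ "k + 1"] exI[of _ "star k"])
      (simp add: pair_graph_star connected_star max_degree_star N_chromatic_number_star)
qed

end
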